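(* Let $n\ge1$ be an integer, $\alpha_1,\dots,\alpha_{n+1},\beta_1,\dots,\beta_n\in\mathbb{C}$ and $\beta_{n+1}=1$. Assume that $\alpha_i-\beta_j\notin\mathbb{Z}$ for all $1\le i,j\le n+1$, that $\alpha_i-\alpha_j\notin\mathbb{Z}$ and $\beta_i-\beta_j\notin\mathbb{Z}$ for all $1\le i,j\le n+1$ with $i\ne j$, and that $\beta_{1,n}-\alpha_{1,n+1}\notin\mathbb{Z}$. Let $C^{(10)}$ be the $(n+1)\times(n+1)$ matrix with entries $$\bigl(C^{(10)}\bigr)_{i,j}=\frac{s(\beta_j-\alpha_j)\,s(\alpha_{n+1})}{s(\beta_i-\alpha_j)\,s(\beta_i-\alpha_{n+1})}\prod_{k=1,\,k\ne i}^{n+1}\frac{s(\alpha_k-\beta_i)}{s(\beta_k-\beta_i)}\quad(1\le i\le n+1,\ 1\le j\le n),$$ $$\bigl(C^{(10)}\bigr)_{i,n+1}=\prod_{k=1,\,k\ne i}^{n+1}\frac{s(\alpha_k-\beta_i)}{s(\beta_k-\beta_i)}\quad(1\le i\le n+1),$$ and let $C^{(01)}$ be the $(n+1)\times(n+1)$ matrix with entries $$\bigl(C^{(01)}\bigr)_{i,j}=-\frac{s(\alpha_i)\,s(\beta_{1,n}-\alpha_{1,n+1}-\beta_j+\alpha_i)\,s(\beta_j-\alpha_j)}{s(\alpha_{n+1})\,s(\beta_{1,n}-\alpha_{1,n+1})\,s(\beta_j-\alpha_i)}\prod_{k=1,\,k\ne i}^{n}\frac{s(\beta_k-\alpha_i)}{s(\alpha_k-\alpha_i)}\quad(1\le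 i\le n,\ 1\le j\le n+1),$$ $$\bigl(C^{(01)}\bigr)_{n+1,j}=-\frac{s(\beta_j-\alpha_j)}{s(\beta_{1,n}-\alpha_{1,n+1})}\quad(1\le j\le n+1).$$ Then $C^{(01)}$ is the inverse of $C^{(10)}$.
   Context: Notation: $s(A)=\sin(\pi A)$ for $A\in\mathbb{C}$; $\alpha_{1,n+1}=\sum_{k=1}^{n+1}\alpha_k$; $\beta_{1,n}=\sum_{k=1}^{n}\beta_k$; the convention $\beta_{n+1}=1$ is used throughout. *)

theory Defs
  imports Complex_Main "Jordan_Normal_Form.Matrix"
begin

text \<open>
  The parameters are families \<open>\<alpha>, \<beta> :: nat \<Rightarrow> complex\<close> of which only the indices
  \<open>1, ..., n + 1\<close> matter; the convention \<open>\<beta> (n + 1) = 1\<close> is imposed where the definitions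
  are used. Entries are indexed from 1; since the rows and columns of the type \<open>mat\<close>
  are indexed from 0, \<open>mat1\<close> shifts the indices.
\<close>

definition s :: "complex \<Rightarrow> complex" where
  "s A = sin (of_real pi * A)"

definition mat1 :: "nat \<Rightarrow> (nat \<Rightarrow> nat \<Rightarrow> complex) \<Rightarrow> complex mat" where
  "mat1 m f = mat m m (\<lambda>(i, j). f (i + 1) (j + 1))"

definition C10 :: "nat \<Rightarrow> (nat \<Rightarrow> complex) \<Rightarrow> (nat \<Rightarrow> complex) \<Rightarrow> complex mat" where
  "C10 n \<alpha> \<beta> = mat1 (n + 1) (\<lambda>i j.
     if j \<le> n then
       s (\<beta> j - \<alpha> j) * s (\<alpha> (n + 1)) / (s (\<beta> i - \<alpha> j) * s (\<beta> i - \<alpha> (n + 1))) *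
       (\<Prod>k\<in>{1..n + 1} - {i}. s (\<alpha> k - \<beta> i) / s (\<beta> k - \<beta> i))
     else
       (\<Prod>k\<in>{1..n + 1} - {i}. s (\<alpha> k - \<beta> i) / s (\<beta> k - \<beta> i)))"

definition C01 :: "nat \<Rightarrow> (nat \<Rightarrow> complex) \<Rightarrow> (nat \<Rightarrow> complex) \<Rightarrow> complex mat" where
  "C01 n \<alpha> \<beta> = mat1 (n + 1) (\<lambda>i j.
     let \<alpha>sum = (\<Sum>k=1..n + 1. \<alpha> k); \<beta>sum = (\<Sum>k=1..n. \<beta> k) in
     if i \<le> n then
       - (s (\<alpha> i) * s (\<beta>sum - \<alpha>sum - \<beta> j + \<alpha> i) * s (\<beta> j - \<alpha> j) /
          (s (\<alpha> (n + 1)) * s (\<beta>sum - \<alpha>sum) * s (\<beta> j - \<alpha> i))) *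
       (\<Prod>k\<in>{1..n} - {i}. s (\<beta> k - \<alpha> i) / s (\<alpha> k - \<alpha> i))
     else
       - (s (\<beta> j - \<alpha> j) / s (\<beta>sum - \<alpha>sum)))"

end

theory Submission
  imports Defs "HOL-Analysis.Complex_Transcendental" "Jordan_Normal_Form.Determinant"
begin

text \<open>
  Everything rests on one trigonometric identity: for equally many points \<open>x\<close> and \<open>y\<close>, the
  \<open>x\<close> pairwise incongruent modulo \<open>\<int>\<close>,
  \[ \sum_k \frac{\prod_m s(y_m - x_k)}{\prod_{m \ne k} s(x_m - x_k)}
     = s\Bigl(\sum_m y_m - \sum_m x_m\Bigr). \]
  In the variables \<open>X = exp (2 \<pi> \<i> x)\<close> and \<open>Y = exp (2 \<pi> \<i> y)\<close> this is Lagrange interpolation at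
  the nodes \<open>X\<^sub>k\<close>, evaluated at \<open>0\<close> (lemmas \<open>Lagrange_zero_sum\<close> and \<open>sine_partial_fraction\<close>).

  Since \<open>\<beta>\<^sub>n\<^sub>+\<^sub>1 = 1\<close>, one has \<open>s \<alpha>\<^sub>k = s (\<beta>\<^sub>n\<^sub>+\<^sub>1 - \<alpha>\<^sub>k)\<close>, so the factor \<open>s \<alpha>\<^sub>k\<close> in \<open>C01\<close> completes
  the product over \<open>\<beta>\<^sub>1, \<dots>, \<beta>\<^sub>n\<close> to one over all \<open>\<beta>\<close>. After this, and up to a common factor,
  the \<open>(i, j)\<close> entry of \<open>C10 * C01\<close> consists of the first \<open>n\<close> terms of the identity and of its
  right-hand side, for the points
  \<open>x = (\<alpha>\<^sub>1, \<dots>, \<alpha>\<^sub>n, \<beta>\<^sub>i)\<close> and for \<open>y\<close> obtained from \<open>(\<beta>\<^sub>1, \<dots>, \<beta>\<^sub>n\<^sub>+\<^sub>1)\<close> by replacing \<open>\<beta>\<^sub>j\<close>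
  so that the sum of \<open>y\<close> becomes \<open>\<alpha>\<^sub>1\<^sub>,\<^sub>n\<^sub>+\<^sub>1 + 1\<close>. The entry is therefore governed by the one
  missing term, at the point \<open>\<beta>\<^sub>i\<close>. For \<open>i \<noteq> j\<close> that term contains the factor
  \<open>s (\<beta>\<^sub>i - \<beta>\<^sub>i) = 0\<close>; for \<open>i = j\<close> it is an explicit product that cancels the common factor
  (lemma \<open>sine_sum_Kronecker_delta\<close>). Thus \<open>C10 * C01 = 1\<close>, and for square matrices over a
  field a right inverse is also a left inverse.
\<close>

section \<open>Zeros and symmetries of the sine\<close>

lemma s_eq_0_iff: "s z = 0 \<longleftrightarrow> z \<in> \<int>"
proof -
  have "s z = 0 \<longleftrightarrow> (\<exists>m::int. of_real pi * z = of_real (of_int m * pi))"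
    by (simp add: s_def sin_eq_0)
  also have "\<dots> \<longleftrightarrow> (\<exists>m::int. z = of_int m)"
    by (auto simp: field_simps)
  also have "\<dots> \<longleftrightarrow> z \<in> \<int>"
    by (auto elim: Ints_cases)
  finally show ?thesis .
qed

lemma s_minus [simp]: "s (- z) = - s z"
  by (simp add: s_def)

lemma s_diff_commute: "s (a - b) = - s (b - a)"
  using s_minus[of "b - a"] by simp

lemma s_one_plus: "s (1 + z) = - s z"
  by (simp add: s_def distrib_left sin_add)

section \<open>A partial fraction identity for sines\<close>

text \<open>
  The polynomials \<open>p = \<Prod>\<^sub>m (Y\<^sub>m - z)\<close> and \<open>q = \<Prod>\<^sub>m (X\<^sub>m - z)\<close> have the same degree and the same
  leading coefficient, and \<open>q\<close> vanishes at all the nodes \<open>X\<^sub>k\<close>. Hence \<open>p - q\<close> is the Lagrange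
  interpolation polynomial of the values \<open>p (X\<^sub>k)\<close>. The identity is its value at \<open>z = 0\<close>,
  divided by \<open>\<Prod>\<^sub>m X\<^sub>m\<close>.
\<close>
lemma Lagrange_zero_sum:
  fixes X Y :: "'i \<Rightarrow> 'a :: field"
  assumes fin: "finite I" "finite J" and card: "card J = card I"
    and inj: "inj_on X I" and nz: "\<And>k. k \<in> I \<Longrightarrow> X k \<noteq> 0"
  shows "(\<Sum>k\<in>I. (\<Prod>m\<in>J. Y m - X k) / (X k * (\<Prod>m\<in>I - {k}. X m - X k))) =
           (\<Prod>m\<in>J. Y m) / (\<Prod>m\<in>I. X m) - 1"
proof -
  define p where "p = (\<Prod>m\<in>J. [:Y m, -1:])"
  define q where "q = (\<Prod>m\<in>I. [:X m, -1:])"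
  define L where "L = (\<lambda>k. \<Prod>m\<in>I - {k}. [:X m, -1:])"
  define c where "c = (\<lambda>k. (\<Prod>m\<in>J. Y m - X k) / (\<Prod>m\<in>I - {k}. X m - X k))"
  \<comment> \<open>the Lagrange interpolation polynomial through the points \<open>(X k, poly p (X k))\<close>\<close>
  define r where "r = (\<Sum>k\<in>I. smult (c k) (L k))"
  have degp: "degree p = card I" and cp: "coeff p (card I) = (-1) ^ card I"
  proof -
    show d: "degree p = card I"
      unfolding p_def by (subst degree_prod_eq_sum_degree) (auto simp: card)
    show "coeff p (card I) = (-1) ^ card I"
      using lead_coeff_prod[of "\<lambda>m. [:Y m, -1:]" J] unfolding p_def[symmetric] d
      by (simp add: card)
  qed
  have degq: "degree q = card I" and cq: "coeff q (card I) = (-1) ^ card I"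
  proof -
    show d: "degree q = card I"
      unfolding q_def by (subst degree_prod_eq_sum_degree) auto
    show "coeff q (card I) = (-1) ^ card I"
      using lead_coeff_prod[of "\<lambda>m. [:X m, -1:]" I] unfolding q_def[symmetric] d
      by simp
  qed
  have degL: "degree (L k) < card I" if "k \<in> I" for k
  proof -
    have "degree (L k) = card (I - {k})"
      unfolding L_def by (subst degree_prod_eq_sum_degree) auto
    thus ?thesis using that fin by (metis card_Diff1_less)
  qed
  have cr: "coeff r (card I) = 0"
    unfolding r_def coeff_sum by (rule sum.neutral) (auto simp: coeff_eq_0 degL)
  have degr: "degree r \<le> card I"
    unfolding r_def using degL
    by (intro degree_sum_le) (auto intro: order.trans[OF degree_smult_le] less_imp_le fin)
  have prodX: "(\<Prod>m\<in>I - {k}. X m - X k) \<noteq> 0" if "k \<in> I" for k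
    using that inj fin by (auto simp: inj_on_def)
  have "p = q + r"
  proof (rule poly_eqI_degree_lead_coeff[where A = "X ` I" and n = "card I"])
    show "degree p \<le> card I" by (simp add: degp)
    show "degree (q + r) \<le> card I" using degq degr by (simp add: degree_add_le)
    show "coeff p (card I) = coeff (q + r) (card I)" by (simp add: cp cq cr)
    show "card I \<le> card (X ` I)" using inj by (simp add: card_image)
    fix z assume "z \<in> X ` I"
    then obtain k where k: "k \<in> I" "z = X k" by auto
    have q0: "poly q z = 0"
      unfolding q_def poly_prod using k fin by (auto intro!: prod_zero)
    have L0: "poly (L l) z = 0" if "l \<in> I" "l \<noteq> k" for l
      unfolding L_def poly_prod using k fin that by (auto intro!: prod_zero)
    have "poly r z = (\<Sum>l\<in>I. if l = k then c k * poly (L k) z else 0)"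
      unfolding r_def poly_sum by (intro sum.cong) (auto simp: L0)
    also have "\<dots> = c k * poly (L k) z" using fin k by simp
    also have "\<dots> = poly p z"
      using prodX[of k] k by (simp add: c_def L_def p_def poly_prod)
    finally show "poly p z = poly (q + r) z" by (simp add: q0)
  qed
  hence "poly p 0 = poly q 0 + poly r 0" by simp
  hence main: "(\<Prod>m\<in>J. Y m) = (\<Prod>m\<in>I. X m) + (\<Sum>k\<in>I. c k * (\<Prod>m\<in>I - {k}. X m))"
    by (simp add: p_def q_def r_def L_def poly_prod poly_sum)
  have PX: "(\<Prod>m\<in>I. X m) \<noteq> 0" using nz fin by simp
  have "(\<Sum>k\<in>I. (\<Prod>m\<in>J. Y m - X k) / (X k * (\<Prod>m\<in>I - {k}. X m - X k))) =
        (\<Sum>k\<in>I. c k * (\<Prod>m\<in>I - {k}. X m) / (\<Prod>m\<in>I. X m))"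
  proof (rule sum.cong)
    fix k assume k: "k \<in> I"
    have "(\<Prod>m\<in>I. X m) = X k * (\<Prod>m\<in>I - {k}. X m)"
      using fin k by (simp add: prod.remove)
    thus "(\<Prod>m\<in>J. Y m - X k) / (X k * (\<Prod>m\<in>I - {k}. X m - X k)) =
          c k * (\<Prod>m\<in>I - {k}. X m) / (\<Prod>m\<in>I. X m)"
      using PX by (simp add: c_def divide_simps)
  qed simp
  also have "\<dots> = ((\<Prod>m\<in>J. Y m) - (\<Prod>m\<in>I. X m)) / (\<Prod>m\<in>I. X m)"
    unfolding main by (simp add: sum_divide_distrib)
  finally show ?thesis using PX by (simp add: diff_divide_distrib)
qed

text \<open>
  With \<open>e z = exp (- \<pi> \<i> z)\<close> and \<open>E z = exp (2 \<pi> \<i> z)\<close> one has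
  \<open>s (b - a) = e a * e b * (E b - E a) / (2 \<i>)\<close>. Because a numerator has exactly one sine more
  than its denominator, the exponential prefactors of the \<open>k\<close>-th summand leave
  \<open>e (x k)\<^sup>2 = 1 / E (x k)\<close> times a factor independent of \<open>k\<close>, which is the form of
  \<open>Lagrange_zero_sum\<close>.
\<close>
lemma sine_partial_fraction:
  fixes x y :: "'i \<Rightarrow> complex"
  assumes fin: "finite I" "finite J" and card: "card J = card I"
    and dist: "\<And>k m. k \<in> I \<Longrightarrow> m \<in> I \<Longrightarrow> k \<noteq> m \<Longrightarrow> x k - x m \<notin> \<int>"
  shows "(\<Sum>k\<in>I. (\<Prod>m\<in>J. s (y m - x k)) / (\<Prod>m\<in>I - {k}. s (x m - x k))) =
           s ((\<Sum>m\<in>J. y m) - (\<Sum>m\<in>I. x m))"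
proof -
  define e where "e = (\<lambda>z::complex. exp (- (\<i> * of_real pi * z)))"
  define E where "E = (\<lambda>z::complex. exp (2 * \<i> * of_real pi * z))"
  have e_nz [simp]: "e z \<noteq> 0" and E_nz [simp]: "E z \<noteq> 0" for z
    by (auto simp: e_def E_def)
  have eeE: "e z * e z * E z = 1" for z
    unfolding e_def E_def by (simp flip: exp_add)
  have e_sum: "(\<Prod>m\<in>A. e (f m)) = e (\<Sum>m\<in>A. f m)" for A :: "'i set" and f
    unfolding e_def by (cases "finite A") (simp_all add: exp_sum sum_distrib_left flip: sum_negf)
  have E_sum: "(\<Prod>m\<in>A. E (f m)) = E (\<Sum>m\<in>A. f m)" for A :: "'i set" and f
    unfolding E_def by (cases "finite A") (simp_all add: exp_sum sum_distrib_left)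
  have s_eE: "s (b - a) = e a * e b * (E b - E a) / (2 * \<i>)" for a b
    unfolding s_def sin_exp_eq e_def E_def
    by (simp add: right_diff_distrib ring_distribs mult_ac flip: exp_add)
  have s_eE': "s (b - a) = e b / e a * (E b / E a - 1) / (2 * \<i>)" for a b
  proof -
    have "e a * E a = 1 / e a" using eeE[of a] by (simp add: eq_divide_eq mult_ac)
    moreover have "e b / e a * (E b / E a - 1) = e b * (E b - E a) / (e a * E a)"
      by (simp add: divide_simps)
    ultimately show ?thesis unfolding s_eE by (simp add: mult_ac)
  qed
  have inj: "inj_on (\<lambda>k. E (x k)) I"
  proof (rule inj_onI, rule ccontr)
    fix k m assume km: "k \<in> I" "m \<in> I" "E (x k) = E (x m)" "k \<noteq> m"
    hence "s (x k - x m) = 0" by (simp add: s_eE)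
    with dist[of k m] km show False by (simp add: s_eq_0_iff)
  qed
  let ?a = "\<Sum>m\<in>J. y m" and ?b = "\<Sum>m\<in>I. x m"
  have "(\<Sum>k\<in>I. (\<Prod>m\<in>J. s (y m - x k)) / (\<Prod>m\<in>I - {k}. s (x m - x k))) =
        (\<Sum>k\<in>I. e ?a / e ?b / (2 * \<i>) * ((\<Prod>m\<in>J. E (y m) - E (x k)) /
          (E (x k) * (\<Prod>m\<in>I - {k}. E (x m) - E (x k)))))"
  proof (rule sum.cong)
    fix k assume k: "k \<in> I"
    define M where "M = card (I - {k})"
    have cI: "card I = Suc M" using k fin M_def by (metis card_Suc_Diff1)
    have b: "e ?b = e (x k) * e (\<Sum>m\<in>I - {k}. x m)"
      using k fin by (simp add: prod.remove flip: e_sum)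
    have num: "(\<Prod>m\<in>J. s (y m - x k)) =
        e (x k) ^ Suc M * e ?a * (\<Prod>m\<in>J. E (y m) - E (x k)) / (2 * \<i>) ^ Suc M"
      unfolding s_eE prod.distrib prod_dividef prod_constant unfolding e_sum card cI by simp
    have den: "(\<Prod>m\<in>I - {k}. s (x m - x k)) =
        e (x k) ^ M * e (\<Sum>m\<in>I - {k}. x m) * (\<Prod>m\<in>I - {k}. E (x m) - E (x k)) / (2 * \<i>) ^ M"
      unfolding s_eE prod.distrib prod_dividef prod_constant unfolding e_sum M_def by simp
    have EX: "E (x k) = 1 / (e (x k) * e (x k))"
      using eeE[of "x k"] by (simp add: eq_divide_eq mult_ac)
    show "(\<Prod>m\<in>J. s (y m - x k)) / (\<Prod>m\<in>I - {k}. s (x m - x k)) =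
        e ?a / e ?b / (2 * \<i>) * ((\<Prod>m\<in>J. E (y m) - E (x k)) /
          (E (x k) * (\<Prod>m\<in>I - {k}. E (x m) - E (x k))))"
    proof -
      define p where "p = (\<Prod>m\<in>J. E (y m) - E (x k))"
      define q where "q = (\<Prod>m\<in>I - {k}. E (x m) - E (x k))"
      show ?thesis
        unfolding num den b p_def[symmetric] q_def[symmetric] EX
        by (simp add: divide_simps)
    qed
  qed simp
  also have "\<dots> = e ?a / e ?b / (2 * \<i>) * ((\<Prod>m\<in>J. E (y m)) / (\<Prod>m\<in>I. E (x m)) - 1)"
    unfolding sum_distrib_left[symmetric]
    by (subst Lagrange_zero_sum) (use fin card inj in auto)
  also have "\<dots> = s (?a - ?b)"
    unfolding E_sum s_eE' by (simp add: divide_simps)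
  finally show ?thesis .
qed

section \<open>The product of the two matrices\<close>

text \<open>
  This is \<open>sine_partial_fraction\<close> with all terms but the one at the point \<open>\<beta> i\<close> moved to the
  left. Admitting \<open>\<beta> i\<close> among the points treats diagonal and off-diagonal entries
  together: for \<open>i \<noteq> j\<close> the factor \<open>s (\<beta> i - \<alpha> k)\<close> in the denominator also occurs in the
  numerator, and the extra term is zero.
\<close>
lemma sine_sum_Kronecker_delta:
  fixes \<alpha> \<beta> :: "nat \<Rightarrow> complex" and n :: nat
  defines "A \<equiv> \<Sum>k=1..n + 1. \<alpha> k" and "B \<equiv> \<Sum>k=1..n. \<beta> k"
  assumes one: "\<beta> (n + 1) = 1"
    and ij: "i \<in> {1..n + 1}" "j \<in> {1..n + 1}"
    and ab: "\<And>k. k \<in> {1..n} \<Longrightarrow> \<alpha> k - \<beta> i \<notin> \<int>"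
    and aa: "\<And>k m. k \<in> {1..n} \<Longrightarrow> m \<in> {1..n} \<Longrightarrow> k \<noteq> m \<Longrightarrow> \<alpha> k - \<alpha> m \<notin> \<int>"
  shows "s (\<beta> i - \<alpha> (n + 1)) + (\<Sum>k=1..n. s (B - A - \<beta> j + \<alpha> k) *
             (\<Prod>m\<in>{1..n + 1} - {j}. s (\<beta> m - \<alpha> k)) /
             (s (\<beta> i - \<alpha> k) * (\<Prod>m\<in>{1..n} - {k}. s (\<alpha> m - \<alpha> k)))) =
         (if i = j then - s (B - A) * (\<Prod>m\<in>{1..n + 1} - {i}. s (\<beta> m - \<beta> i)) /
             (\<Prod>m=1..n. s (\<alpha> m - \<beta> i)) else 0)"
proof -
  define x where "x = \<alpha>(n + 1 := \<beta> i)"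
  \<comment> \<open>The replacement value makes \<open>s (y j - \<alpha> k)\<close> equal to \<open>- s (B - A - \<beta> j + \<alpha> k)\<close>.\<close>
  define y where "y = \<beta>(j := A - B + \<beta> j)"
  let ?I = "{1..n + 1}"
  have I: "?I = insert (n + 1) {1..n}" by auto
  have xk: "x k = \<alpha> k" if "k \<in> {1..n}" for k using that by (auto simp: x_def)
  have dist: "x k - x m \<notin> \<int>" if "k \<in> ?I" "m \<in> ?I" "k \<noteq> m" for k m
  proof -
    have "\<beta> i - \<alpha> k \<notin> \<int>" if "k \<in> {1..n}" for k
      using ab[OF that] Ints_minus[of "\<beta> i - \<alpha> k"] by auto
    thus ?thesis using that ab aa unfolding I by (auto simp: x_def)
  qed
  have num: "(\<Prod>m\<in>?I. s (y m - z)) = s (A - B + \<beta> j - z) * (\<Prod>m\<in>?I - {j}. s (\<beta> m - z))" for z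
    using ij by (subst prod.remove[of _ j]) (auto simp: y_def intro!: prod.cong)
  have sumx: "(\<Sum>k\<in>?I. x k) = A - \<alpha> (n + 1) + \<beta> i"
  proof -
    have "(\<Sum>k\<in>?I. x k) = \<beta> i + (\<Sum>k=1..n. x k)" by (simp add: x_def)
    also have "(\<Sum>k=1..n. x k) = (\<Sum>k=1..n. \<alpha> k)" by (intro sum.cong) (auto simp: xk)
    finally show ?thesis by (simp add: A_def)
  qed
  have sumy: "(\<Sum>k\<in>?I. y k) = 1 + A"
  proof -
    have "(\<Sum>k\<in>?I. y k) = A - B + \<beta> j + (\<Sum>k\<in>?I - {j}. \<beta> k)"
      using ij by (subst sum.remove[of _ j]) (auto simp: y_def intro!: sum.cong)
    also have "\<dots> = A - B + (\<Sum>k\<in>?I. \<beta> k)"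
      using ij by (subst sum.remove[of ?I j \<beta>]) auto
    also have "(\<Sum>k\<in>?I. \<beta> k) = B + 1" using one by (simp add: B_def)
    finally show ?thesis by simp
  qed
  let ?t = "\<lambda>k. (\<Prod>m\<in>?I. s (y m - x k)) / (\<Prod>m\<in>?I - {k}. s (x m - x k))"
  have "(\<Sum>k\<in>?I. ?t k) = s (1 + A - (A - \<alpha> (n + 1) + \<beta> i))"
    unfolding sumx[symmetric] sumy[symmetric]
    by (rule sine_partial_fraction) (use dist in auto)
  also have "\<dots> = s (\<beta> i - \<alpha> (n + 1))"
    using s_one_plus[of "\<alpha> (n + 1) - \<beta> i"] s_diff_commute[of "\<beta> i" "\<alpha> (n + 1)"]
    by (simp add: algebra_simps)
  finally have total: "(\<Sum>k=1..n. ?t k) + ?t (n + 1) = s (\<beta> i - \<alpha> (n + 1))" by simp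
  have old: "?t k = - (s (B - A - \<beta> j + \<alpha> k) * (\<Prod>m\<in>?I - {j}. s (\<beta> m - \<alpha> k)) /
        (s (\<beta> i - \<alpha> k) * (\<Prod>m\<in>{1..n} - {k}. s (\<alpha> m - \<alpha> k))))" if k: "k \<in> {1..n}" for k
  proof -
    have "?I - {k} = insert (n + 1) ({1..n} - {k})" using k by auto
    hence "(\<Prod>m\<in>?I - {k}. s (x m - x k)) =
        s (\<beta> i - \<alpha> k) * (\<Prod>m\<in>{1..n} - {k}. s (x m - x k))"
      using k by (simp add: x_def)
    also have "(\<Prod>m\<in>{1..n} - {k}. s (x m - x k)) = (\<Prod>m\<in>{1..n} - {k}. s (\<alpha> m - \<alpha> k))"
      using k by (intro prod.cong) (auto simp: xk)
    finally have den: "(\<Prod>m\<in>?I - {k}. s (x m - x k)) =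
        s (\<beta> i - \<alpha> k) * (\<Prod>m\<in>{1..n} - {k}. s (\<alpha> m - \<alpha> k))" .
    have "s (A - B + \<beta> j - \<alpha> k) = - s (B - A - \<beta> j + \<alpha> k)"
      using s_minus[of "B - A - \<beta> j + \<alpha> k"] by (simp add: algebra_simps)
    thus ?thesis unfolding num den using xk[OF k] by simp
  qed
  have new: "?t (n + 1) = s (A - B + \<beta> j - \<beta> i) * (\<Prod>m\<in>?I - {j}. s (\<beta> m - \<beta> i)) /
      (\<Prod>m=1..n. s (\<alpha> m - \<beta> i))"
  proof -
    have "?I - {n + 1} = {1..n}" by auto
    moreover have "(\<Prod>m=1..n. s (x m - x (n + 1))) = (\<Prod>m=1..n. s (\<alpha> m - \<beta> i))"
      by (intro prod.cong) (auto simp: x_def)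
    ultimately have den: "(\<Prod>m\<in>?I - {n + 1}. s (x m - x (n + 1))) = (\<Prod>m=1..n. s (\<alpha> m - \<beta> i))"
      by simp
    have "x (n + 1) = \<beta> i" by (simp add: x_def)
    thus ?thesis unfolding num den by simp
  qed
  have new': "?t (n + 1) = (if i = j then - s (B - A) * (\<Prod>m\<in>?I - {i}. s (\<beta> m - \<beta> i)) /
             (\<Prod>m=1..n. s (\<alpha> m - \<beta> i)) else 0)"
  proof (cases "i = j")
    case True
    thus ?thesis unfolding new using s_diff_commute[of A B] by simp
  next
    case False
    hence "(\<Prod>m\<in>?I - {j}. s (\<beta> m - \<beta> i)) = 0"
      using ij by (intro prod_zero) (auto simp: s_def intro!: bexI[of _ i])
    with False show ?thesis unfolding new by simp
  qed
  have "(\<Sum>k=1..n. ?t k) = - (\<Sum>k=1..n. s (B - A - \<beta> j + \<alpha> k) *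
             (\<Prod>m\<in>?I - {j}. s (\<beta> m - \<alpha> k)) /
             (s (\<beta> i - \<alpha> k) * (\<Prod>m\<in>{1..n} - {k}. s (\<alpha> m - \<alpha> k))))"
    unfolding sum_negf[symmetric] by (intro sum.cong refl old)
  with total new' show ?thesis by (simp add: algebra_simps)
qed

theorem theorem3p6:
  fixes n :: nat and \<alpha> \<beta> :: "nat \<Rightarrow> complex"
  assumes "n \<ge> 1"
    and "\<beta> (n + 1) = 1"
    and "\<And>i j. i \<in> {1..n + 1} \<Longrightarrow> j \<in> {1..n + 1} \<Longrightarrow> \<alpha> i - \<beta> j \<notin> \<int>"
    and "\<And>i j. i \<in> {1..n + 1} \<Longrightarrow> j \<in> {1..n + 1} \<Longrightarrow> i \<noteq> j \<Longrightarrow> \<alpha> i - \<alpha> j \<notin> \<int>"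
    and "\<And>i j. i \<in> {1..n + 1} \<Longrightarrow> j \<in> {1..n + 1} \<Longrightarrow> i \<noteq> j \<Longrightarrow> \<beta> i - \<beta> j \<notin> \<int>"
    and "(\<Sum>k=1..n. \<beta> k) - (\<Sum>k=1..n + 1. \<alpha> k) \<notin> \<int>"
  shows "inverts_mat (C10 n \<alpha> \<beta>) (C01 n \<alpha> \<beta>) \<and> inverts_mat (C01 n \<alpha> \<beta>) (C10 n \<alpha> \<beta>)"
proof -
  define N where "N = n + 1"
  define A where "A = (\<Sum>k=1..n + 1. \<alpha> k)"
  define B where "B = (\<Sum>k=1..n. \<beta> k)"
  define P where "P = (\<lambda>i. \<Prod>k\<in>{1..n + 1} - {i}. s (\<alpha> k - \<beta> i) / s (\<beta> k - \<beta> i))"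
  define Q where "Q = (\<lambda>i. \<Prod>k\<in>{1..n} - {i}. s (\<beta> k - \<alpha> i) / s (\<alpha> k - \<alpha> i))"
  define f where "f = (\<lambda>i j. if j \<le> n
      then s (\<beta> j - \<alpha> j) * s (\<alpha> (n + 1)) / (s (\<beta> i - \<alpha> j) * s (\<beta> i - \<alpha> (n + 1))) * P i
      else P i)"
  define g where "g = (\<lambda>i j. if i \<le> n
      then - (s (\<alpha> i) * s (B - A - \<beta> j + \<alpha> i) * s (\<beta> j - \<alpha> j) /
          (s (\<alpha> (n + 1)) * s (B - A) * s (\<beta> j - \<alpha> i))) * Q i
      else - (s (\<beta> j - \<alpha> j) / s (B - A)))"
  have C10: "C10 n \<alpha> \<beta> = mat1 N f"
    unfolding C10_def N_def f_def P_def ..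
  have C01: "C01 n \<alpha> \<beta> = mat1 N g"
    unfolding C01_def N_def g_def Q_def A_def B_def Let_def ..
  have nzab: "s (\<alpha> k - \<beta> i) \<noteq> 0" and nzba: "s (\<beta> i - \<alpha> k) \<noteq> 0"
    if "k \<in> {1..n + 1}" "i \<in> {1..n + 1}" for k i
    using assms(3)[OF that] s_diff_commute[of "\<beta> i" "\<alpha> k"] by (auto simp: s_eq_0_iff)
  have nzbb: "s (\<beta> k - \<beta> i) \<noteq> 0" if "k \<in> {1..n + 1}" "i \<in> {1..n + 1}" "k \<noteq> i" for k i
    using assms(5)[OF that] by (simp add: s_eq_0_iff)
  have nzBA: "s (B - A) \<noteq> 0" using assms(6) by (simp add: s_eq_0_iff A_def B_def)
  have s_alpha: "s (\<alpha> k) = s (\<beta> (n + 1) - \<alpha> k)" for k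
    using s_one_plus[of "- \<alpha> k"] assms(2) by simp
  have nza: "s (\<alpha> (n + 1)) \<noteq> 0" using nzba[of "n + 1" "n + 1"] by (simp add: s_alpha)
  have entry: "(\<Sum>k\<in>{1..n + 1}. f i k * g k j) = (if i = j then 1 else 0)"
    if i: "i \<in> {1..n + 1}" and j: "j \<in> {1..n + 1}" for i j
  proof -
    \<comment> \<open>the common factor of all \<open>n + 1\<close> summands\<close>
    define K where "K = - (s (\<beta> j - \<alpha> j) / (s (B - A) * s (\<beta> i - \<alpha> (n + 1))) * P i)"
    define T where "T = (\<lambda>k. s (B - A - \<beta> j + \<alpha> k) *
             (\<Prod>m\<in>{1..n + 1} - {j}. s (\<beta> m - \<alpha> k)) /
             (s (\<beta> i - \<alpha> k) * (\<Prod>m\<in>{1..n} - {k}. s (\<alpha> m - \<alpha> k))))"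
    have nzi: "s (\<beta> i - \<alpha> (n + 1)) \<noteq> 0" using nzba[of "n + 1" i] i by simp
    have small: "f i k * g k j = K * T k" if k: "k \<in> {1..n}" for k
    proof -
      define R where "R = (\<Prod>m\<in>{1..n} - {k}. s (\<beta> m - \<alpha> k))"
      define R' where "R' = (\<Prod>m\<in>{1..n + 1} - {j}. s (\<beta> m - \<alpha> k))"
      define D where "D = (\<Prod>m\<in>{1..n} - {k}. s (\<alpha> m - \<alpha> k))"
      have kI: "k \<in> {1..n + 1}" using k by auto
      have "(\<Prod>m\<in>{1..n + 1}. s (\<beta> m - \<alpha> k)) = s (\<alpha> k) * (\<Prod>m\<in>{1..n}. s (\<beta> m - \<alpha> k))"
        by (simp add: s_alpha)
      also have "\<dots> = s (\<alpha> k) * (s (\<beta> k - \<alpha> k) * R)"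
        unfolding R_def using k by (subst prod.remove[of _ k]) auto
      finally have full: "s (\<beta> j - \<alpha> k) * R' = s (\<alpha> k) * s (\<beta> k - \<alpha> k) * R"
        unfolding R'_def using j by (subst prod.remove[of _ j, symmetric]) (auto simp: mult_ac)
      hence R': "R' = s (\<alpha> k) * s (\<beta> k - \<alpha> k) * R / s (\<beta> j - \<alpha> k)"
        using nzba[OF kI j] by (simp add: field_simps)
      have Q: "Q k = R / D" by (simp add: Q_def R_def D_def prod_dividef)
      show ?thesis
        using k nza unfolding T_def R'_def[symmetric] D_def[symmetric] R' K_def f_def g_def Q
        by (simp add: mult_ac)
    qed
    have last: "f i (n + 1) * g (n + 1) j = K * s (\<beta> i - \<alpha> (n + 1))"
      using nzi by (simp add: f_def g_def K_def)
    have "(\<Sum>k\<in>{1..n + 1}. f i k * g k j) =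
        (\<Sum>k\<in>{1..n}. f i k * g k j) + f i (n + 1) * g (n + 1) j" by simp
    also have "(\<Sum>k\<in>{1..n}. f i k * g k j) = (\<Sum>k\<in>{1..n}. K * T k)"
      by (intro sum.cong refl small)
    also have "(\<Sum>k\<in>{1..n}. K * T k) + f i (n + 1) * g (n + 1) j =
        K * (s (\<beta> i - \<alpha> (n + 1)) + (\<Sum>k\<in>{1..n}. T k))"
      unfolding last by (simp add: distrib_left sum_distrib_left)
    also have "s (\<beta> i - \<alpha> (n + 1)) + (\<Sum>k\<in>{1..n}. T k) =
        (if i = j then - s (B - A) * (\<Prod>m\<in>{1..n + 1} - {i}. s (\<beta> m - \<beta> i)) /
             (\<Prod>m=1..n. s (\<alpha> m - \<beta> i)) else 0)"
      unfolding T_def A_def B_def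
      by (rule sine_sum_Kronecker_delta) (use assms(2-4) i j in auto)
    also have "K * \<dots> = (if i = j then 1 else 0)"
    proof (cases "i = j")
      case True
      define U where "U = (\<Prod>m\<in>{1..n + 1} - {i}. s (\<alpha> m - \<beta> i))"
      define V where "V = (\<Prod>m\<in>{1..n + 1} - {i}. s (\<beta> m - \<beta> i))"
      define W where "W = (\<Prod>m=1..n. s (\<alpha> m - \<beta> i))"
      have P: "P i = U / V" by (simp add: P_def U_def V_def prod_dividef)
      have V: "V \<noteq> 0" using nzbb i by (auto simp: V_def)
      have W: "W \<noteq> 0" using nzab i by (auto simp: W_def)
      \<comment> \<open>\<open>U\<close> lacks the factor \<open>m = i\<close> and \<open>W\<close> the factor \<open>m = n + 1\<close> of one and the same product.\<close>
      have "s (\<alpha> i - \<beta> i) * U = (\<Prod>m\<in>{1..n + 1}. s (\<alpha> m - \<beta> i))"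
        unfolding U_def using i by (subst prod.remove[of _ i]) auto
      also have "\<dots> = s (\<alpha> (n + 1) - \<beta> i) * W" by (simp add: W_def mult_ac)
      finally have UW: "s (\<beta> i - \<alpha> i) * U = s (\<beta> i - \<alpha> (n + 1)) * W"
        using s_diff_commute[of "\<alpha> i" "\<beta> i"] s_diff_commute[of "\<alpha> (n + 1)" "\<beta> i"] by simp
      have "K * (- s (B - A) * V / W) = s (\<beta> i - \<alpha> i) * U / (s (\<beta> i - \<alpha> (n + 1)) * W)"
        using V nzBA True by (simp add: K_def P[unfolded True] field_simps)
      also have "\<dots> = 1" unfolding UW using nzi W by simp
      finally show ?thesis using True by (simp add: V_def W_def)
    qed simp
    finally show ?thesis .
  qed
  have prod: "mat1 N f * mat1 N g = 1\<^sub>m N"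
  proof (rule eq_matI)
    fix a b assume "a < dim_row (1\<^sub>m N :: complex mat)" "b < dim_col (1\<^sub>m N :: complex mat)"
    hence ab: "a < N" "b < N" by auto
    have "(mat1 N f * mat1 N g) $$ (a, b) = (\<Sum>k<N. f (a + 1) (k + 1) * g (k + 1) (b + 1))"
      using ab by (simp add: mat1_def scalar_prod_def lessThan_atLeast0)
    also have "\<dots> = (\<Sum>k\<in>{1..n + 1}. f (a + 1) k * g k (b + 1))"
      by (rule sum.reindex_bij_witness[of _ "\<lambda>k. k - 1" "\<lambda>k. k + 1"]) (auto simp: N_def)
    also have "\<dots> = (if a + 1 = b + 1 then 1 else 0)"
      using ab by (intro entry) (auto simp: N_def)
    finally show "(mat1 N f * mat1 N g) $$ (a, b) = 1\<^sub>m N $$ (a, b)"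
      using ab by simp
  qed (auto simp: mat1_def)
  have carr: "mat1 N h \<in> carrier_mat N N" for h by (simp add: mat1_def)
  have "mat1 N g * mat1 N f = 1\<^sub>m N"
    by (rule mat_mult_left_right_inverse[OF carr carr prod])
  with prod show ?thesis
    by (simp add: C10 C01 inverts_mat_def mat1_def)
qed

end
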